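(* Any Extended Polynomial Calculus with square root refutation over $\mathbb{Z}$ (denoted $\mathsf{Ext}$-$\mathsf{PC}^{\sqrt{\ }}_{\mathbb{Z}}$) of $\mathsf{BVP}_n$ requires size $\Omega(2^n)$. Moreover, the absolute value of the nonzero constant $M$ at the end of such a refutation consists of at least $C \cdot 2^n$ bits for some constant $C > 0$, and $M$ is divisible by every prime number less than $2^n$.
   Context: $\mathsf{BVP}_n$ (Binary Value Principle) is the unsatisfiable system $x_1 + 2x_2 + \ldots + 2^{n-1}x_n + 1 = 0$, $x_i^2 - x_i = 0$ for $i=1,\ldots,n$. A $\mathsf{PC}^{\sqrt{\ }}_R$ refutation (Polynomial Calculus with square root over a ring $R$) of a set $\Gamma$ of polynomials is a sequence $R_1,\ldots,R_s$ with $R_s = M$ a nonzero constant of $R$, where each $R_l$ is in $\Gamma$ or is obtained from earlier lines by: $R_l = \alpha R_j + \beta R_k$ with $\alpha,\beta \in R$; $R_l = x_i R_k$ (multiplication by a variable); or $R_l^2 = R_k$ (square root rule). Its size is the sum of the sizes of the lines, where the size of an integer polynomial is $\sum \lceil \log |a_i|\rceil$ over its coefficients $a_i$ (for rational coefficients $p_i/q_i$, $\sum \lceil\log|p_i|\rceil + \lceil \log |q_i|\rceil$). An $\mathsf{Ext}$-$\mathsf{PC}^{\sqrt{\ }}_R$ refutation of $\Gamma$ is a $\mathsf{PC}^{\sqrt{\ }}_R$ refutation of $\Gamma \cup \{y_1 - Q_1(\vec x), y_2 - Q_2(\vec x, y_1), \ldots, y_m - Q_m(\vec x, y_1,\ldots,y_{m-1})\}$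 for arbitrary polynomials $Q_i$ over $R$ (extension variables $y_i$, which may also be used in multiplication steps); its size is the size of that refutation. *)

theory Defs
  imports Complex_Main "HOL-Library.Poly_Mapping" "HOL-Library.Log_Nat"
    "HOL-Computational_Algebra.Primes"
begin

text \<open>A polynomial maps each monomial (a finitely supported exponent vector) to its coefficient;
  the ring operations are those of Poly_Mapping.\<close>

type_synonym ('v, 'a) mpoly = "('v \<Rightarrow>\<^sub>0 nat) \<Rightarrow>\<^sub>0 'a"

definition Const :: "'a::zero \<Rightarrow> ('v, 'a) mpoly" where
  "Const c = Poly_Mapping.single 0 c"

definition Var :: "'v \<Rightarrow> ('v, 'a::zero_neq_one) mpoly" where
  "Var v = Poly_Mapping.single (Poly_Mapping.single v 1) 1"

definition vars :: "('v, 'a::zero) mpoly \<Rightarrow> 'v set" where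
  "vars p = (\<Union>m\<in>Poly_Mapping.keys p. Poly_Mapping.keys m)"

text \<open>The rules of the Polynomial Calculus with square root: line \<open>l\<close> of \<open>R\<close> is an axiom, or it
  follows from strictly earlier lines. \<open>V\<close> is the set of variables of the polynomial ring.\<close>

definition pc_sqrt_step ::
  "'v set \<Rightarrow> ('v, 'a::comm_ring_1) mpoly set \<Rightarrow> ('v, 'a) mpoly list \<Rightarrow> nat \<Rightarrow> bool" where
  "pc_sqrt_step V \<Gamma> R l \<longleftrightarrow>
     R ! l \<in> \<Gamma>
   \<or> (\<exists>j<l. \<exists>k<l. \<exists>\<alpha> \<beta>. R ! l = Const \<alpha> * R ! j + Const \<beta> * R ! k)
   \<or> (\<exists>k<l. \<exists>v\<in>V. R ! l = Var v * R ! k)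
   \<or> (\<exists>k<l. (R ! l)\<^sup>2 = R ! k)"

definition pc_sqrt_refutation ::
  "'v set \<Rightarrow> ('v, 'a::comm_ring_1) mpoly set \<Rightarrow> ('v, 'a) mpoly list \<Rightarrow> 'a \<Rightarrow> bool" where
  "pc_sqrt_refutation V \<Gamma> R M \<longleftrightarrow>
     (\<forall>p\<in>set R. vars p \<subseteq> V) \<and>
     (\<forall>l<length R. pc_sqrt_step V \<Gamma> R l) \<and>
     R \<noteq> [] \<and> last R = Const M \<and> M \<noteq> 0"

text \<open>Original variables \<open>X 1, X 2, \<dots>\<close> and extension variables \<open>Y 1, Y 2, \<dots>\<close>.\<close>

datatype indet = X nat | Y nat

text \<open>Here \<open>\<Gamma>\<close> is a system in the variables \<open>X 1, \<dots>, X n\<close>. Lists are indexed from \<open>0\<close>, so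
  \<open>Q ! j\<close> defines \<open>Y (j + 1)\<close> and may use \<open>Y 1, \<dots>, Y j\<close>.\<close>

definition ext_pc_sqrt_refutation ::
  "nat \<Rightarrow> (indet, 'a::comm_ring_1) mpoly set \<Rightarrow> (indet, 'a) mpoly list \<Rightarrow>
   (indet, 'a) mpoly list \<Rightarrow> 'a \<Rightarrow> bool" where
  "ext_pc_sqrt_refutation n \<Gamma> Q R M \<longleftrightarrow>
     (\<forall>j<length Q. vars (Q ! j) \<subseteq> X ` {1..n} \<union> Y ` {1..j}) \<and>
     pc_sqrt_refutation (X ` {1..n} \<union> Y ` {1..length Q})
       (\<Gamma> \<union> {Var (Y (j + 1)) - Q ! j | j. j < length Q}) R M"

definition poly_bits :: "('v, int) mpoly \<Rightarrow> int" where
  "poly_bits p =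
     (\<Sum>m\<in>Poly_Mapping.keys p. \<lceil>log 2 (real_of_int \<bar>Poly_Mapping.lookup p m\<bar>)\<rceil>)"

definition refutation_bits :: "('v, int) mpoly list \<Rightarrow> int" where
  "refutation_bits R = (\<Sum>p\<leftarrow>R. poly_bits p)"

definition BVP :: "nat \<Rightarrow> (indet, 'a::comm_ring_1) mpoly set" where
  "BVP n = insert ((\<Sum>i=1..n. Const (2 ^ (i - 1)) * Var (X i)) + 1)
                  {(Var (X i))\<^sup>2 - Var (X i) | i. i \<in> {1..n}}"

end

theory Submission
  imports Defs
begin

text \<open>For a prime \<open>p \<le> 2\<^sup>n\<close>, the binary digits of \<open>p - 1\<close> satisfy \<open>BVP n\<close> modulo \<open>p\<close>, and the
  extension axioms can be satisfied exactly by computing the extension variables one after the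
  other. All rules are sound modulo \<open>p\<close>, the square root rule because \<open>p\<close> is prime, so \<open>p\<close> divides
  the final constant \<open>M\<close>. Hence \<open>M\<close> is a nonzero multiple of the primorial of \<open>N = 2\<^sup>n\<close>, which has
  \<open>\<Omega>(N)\<close> bits by Chebyshev's estimate: \<open>m * (2 * m choose m)\<close> divides \<open>Lcm {1..2 * m}\<close>, so the
  latter is at least \<open>4\<^sup>m / 2\<close>, and replacing the prime powers in the least common multiple by primes
  costs at most a factor \<open>N\<close> for each prime up to \<open>sqrt N\<close>. Since \<open>p = 2\<close> is covered even for \<open>n = 1\<close>,
  \<open>\<bar>M\<bar> \<ge> 2\<close> always, which settles small \<open>n\<close>.\<close>

section \<open>Evaluation of polynomials\<close>

definition eval_monom :: "('v \<Rightarrow> 'a::comm_ring_1) \<Rightarrow> ('v \<Rightarrow>\<^sub>0 nat) \<Rightarrow> 'a" where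
  "eval_monom \<rho> m = (\<Prod>v\<in>Poly_Mapping.keys m. \<rho> v ^ Poly_Mapping.lookup m v)"

text \<open>Coefficients and values share one ring. With integers throughout, working modulo a prime
  is expressed by divisibility of values, without a passage to a residue field.\<close>

definition eval_mpoly :: "('v \<Rightarrow> 'a::comm_ring_1) \<Rightarrow> ('v, 'a) mpoly \<Rightarrow> 'a" where
  "eval_mpoly \<rho> p = (\<Sum>m\<in>Poly_Mapping.keys p. Poly_Mapping.lookup p m * eval_monom \<rho> m)"

text \<open>Additional variables have exponent 0 and contribute factors 1. Two monomials can thus be
  evaluated over a common index set, as \<open>eval_monom_add\<close> requires.\<close>

lemma eval_monom_superset:
  assumes "finite A" "Poly_Mapping.keys m \<subseteq> A"
  shows "eval_monom \<rho> m = (\<Prod>v\<in>A. \<rho> v ^ Poly_Mapping.lookup m v)"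
  unfolding eval_monom_def
  by (rule prod.mono_neutral_left) (use assms in \<open>auto simp: in_keys_iff\<close>)

lemma eval_mpoly_superset:
  assumes "finite A" "Poly_Mapping.keys p \<subseteq> A"
  shows "eval_mpoly \<rho> p = (\<Sum>m\<in>A. Poly_Mapping.lookup p m * eval_monom \<rho> m)"
  unfolding eval_mpoly_def
  by (rule sum.mono_neutral_left) (use assms in \<open>auto simp: in_keys_iff\<close>)

lemma eval_monom_add: "eval_monom \<rho> (a + b) = eval_monom \<rho> a * eval_monom \<rho> b"
proof -
  let ?A = "Poly_Mapping.keys a \<union> Poly_Mapping.keys b"
  have "eval_monom \<rho> (a + b) = (\<Prod>v\<in>?A. \<rho> v ^ Poly_Mapping.lookup (a + b) v)"
    by (rule eval_monom_superset) (use Poly_Mapping.keys_add[of a b] in auto)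
  also have "\<dots> = (\<Prod>v\<in>?A. \<rho> v ^ Poly_Mapping.lookup a v) * (\<Prod>v\<in>?A. \<rho> v ^ Poly_Mapping.lookup b v)"
    by (simp add: lookup_add power_add prod.distrib)
  also have "\<dots> = eval_monom \<rho> a * eval_monom \<rho> b"
    by (subst (1 2) eval_monom_superset[of ?A]) auto
  finally show ?thesis .
qed

lemma eval_mpoly_add: "eval_mpoly \<rho> (p + q) = eval_mpoly \<rho> p + eval_mpoly \<rho> q"
proof -
  let ?A = "Poly_Mapping.keys p \<union> Poly_Mapping.keys q"
  have "eval_mpoly \<rho> (p + q) = (\<Sum>m\<in>?A. Poly_Mapping.lookup (p + q) m * eval_monom \<rho> m)"
    by (rule eval_mpoly_superset) (use Poly_Mapping.keys_add[of p q] in auto)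
  also have "\<dots> = (\<Sum>m\<in>?A. Poly_Mapping.lookup p m * eval_monom \<rho> m)
                   + (\<Sum>m\<in>?A. Poly_Mapping.lookup q m * eval_monom \<rho> m)"
    by (simp add: lookup_add distrib_right sum.distrib)
  also have "\<dots> = eval_mpoly \<rho> p + eval_mpoly \<rho> q"
    by (subst (1 2) eval_mpoly_superset[of ?A]) auto
  finally show ?thesis .
qed

lemma eval_mpoly_zero [simp]: "eval_mpoly \<rho> 0 = 0"
  by (simp add: eval_mpoly_def)

lemma eval_mpoly_single: "eval_mpoly \<rho> (Poly_Mapping.single m c) = c * eval_monom \<rho> m"
  by (simp add: eval_mpoly_def)

lemma eval_mpoly_sum: "eval_mpoly \<rho> (\<Sum>i\<in>A. f i) = (\<Sum>i\<in>A. eval_mpoly \<rho> (f i))"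
  by (induction A rule: infinite_finite_induct) (auto simp: eval_mpoly_add)

lemma eval_mpoly_diff: "eval_mpoly \<rho> (p - q) = eval_mpoly \<rho> p - eval_mpoly \<rho> q"
  using eval_mpoly_add[of \<rho> "p - q" q] by simp

lemma mpoly_eq_sum_single:
  fixes p :: "('v, 'a::comm_ring_1) mpoly"
  shows "p = (\<Sum>m\<in>Poly_Mapping.keys p. Poly_Mapping.single m (Poly_Mapping.lookup p m))"
  by (rule poly_mapping_eqI)
     (auto simp: lookup_sum lookup_single when_def in_keys_iff sum.delta')

lemma eval_mpoly_mult: "eval_mpoly \<rho> (p * q) = eval_mpoly \<rho> p * eval_mpoly \<rho> q"
proof -
  have "p * q = (\<Sum>a\<in>Poly_Mapping.keys p. \<Sum>b\<in>Poly_Mapping.keys q.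
          Poly_Mapping.single (a + b) (Poly_Mapping.lookup p a * Poly_Mapping.lookup q b))"
    using arg_cong2[of _ _ _ _ "(*)", OF mpoly_eq_sum_single[of p] mpoly_eq_sum_single[of q]]
    by (simp only: sum_product mult_single)
  then show ?thesis
    by (simp add: eval_mpoly_sum eval_mpoly_single eval_monom_add)
       (simp add: eval_mpoly_def sum_product mult_ac)
qed

lemma eval_mpoly_Const [simp]: "eval_mpoly \<rho> (Const c) = c"
  by (simp add: Const_def eval_mpoly_single eval_monom_def)

lemma eval_mpoly_Var [simp]: "eval_mpoly \<rho> (Var v) = \<rho> v"
  by (simp add: Var_def eval_mpoly_single eval_monom_def)

lemma eval_mpoly_one [simp]: "eval_mpoly \<rho> 1 = 1"
  using eval_mpoly_Const[of \<rho> 1] by (simp add: Const_def)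

lemma eval_mpoly_power2: "eval_mpoly \<rho> (p\<^sup>2) = (eval_mpoly \<rho> p)\<^sup>2"
  by (simp add: power2_eq_square eval_mpoly_mult)

lemma eval_mpoly_cong:
  assumes "\<And>v. v \<in> vars p \<Longrightarrow> \<rho> v = \<sigma> v"
  shows "eval_mpoly \<rho> p = eval_mpoly \<sigma> p"
  unfolding eval_mpoly_def eval_monom_def
  by (intro sum.cong prod.cong arg_cong2[of _ _ _ _ "(*)"] arg_cong2[of _ _ _ _ "(^)"] refl assms)
     (auto simp: vars_def)

section \<open>Divisibility of the final constant\<close>

text \<open>Soundness modulo \<open>q\<close>, by strong induction on the line number. Linear
  combinations and multiplication by a variable preserve divisibility by any integer; the square
  root rule preserves it because a prime dividing a square divides its root.\<close>

lemma prime_dvd_eval_refutation: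
  fixes q :: int
  assumes "prime q" "pc_sqrt_refutation V \<Gamma> R M"
    and ax: "\<And>g. g \<in> \<Gamma> \<Longrightarrow> q dvd eval_mpoly \<rho> g"
  shows "q dvd M"
proof -
  have line: "q dvd eval_mpoly \<rho> (R ! l)" if "l < length R" for l
    using that
  proof (induction l rule: less_induct)
    case (less l)
    have IH: "q dvd eval_mpoly \<rho> (R ! k)" if "k < l" for k
      using less that by simp
    have "pc_sqrt_step V \<Gamma> R l"
      using less.prems assms(2) by (auto simp: pc_sqrt_refutation_def)
    then consider "R ! l \<in> \<Gamma>"
      | j k \<alpha> \<beta> where "j < l" "k < l" "R ! l = Const \<alpha> * R ! j + Const \<beta> * R ! k"
      | k v where "k < l" "R ! l = Var v * R ! k"
      | k where "k < l" "(R ! l)\<^sup>2 = R ! k"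
      unfolding pc_sqrt_step_def by blast
    then show ?case
    proof cases
      case 4
      then have "q dvd (eval_mpoly \<rho> (R ! l))\<^sup>2"
        using IH[of k] by (simp flip: eval_mpoly_power2)
      then show ?thesis
        using \<open>prime q\<close> prime_dvd_power by blast
    qed (use ax IH in \<open>auto simp: eval_mpoly_add eval_mpoly_mult\<close>)
  qed
  have "R \<noteq> []" "last R = Const M"
    using assms(2) by (auto simp: pc_sqrt_refutation_def)
  then show ?thesis
    using line[of "length R - 1"] by (simp add: last_conv_nth)
qed

section \<open>Assignments satisfying the axioms modulo a prime\<close>

lemma bit_assignment_exists:
  "k < 2 ^ n \<Longrightarrow> \<exists>b :: nat \<Rightarrow> int. (\<forall>i. b i \<in> {0, 1}) \<and> (\<Sum>i=1..n. 2 ^ (i - 1) * b i) = int k"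
proof (induction n arbitrary: k)
  case 0
  then show ?case by (intro exI[of _ "\<lambda>_. 0"]) auto
next
  case (Suc n)
  define c where "c = (if k < 2 ^ n then 0 else 1 :: nat)"
  have "k - c * 2 ^ n < 2 ^ n" and k: "k = (k - c * 2 ^ n) + c * 2 ^ n"
    using Suc.prems by (auto simp: c_def)
  from Suc.IH[OF this(1)] obtain b :: "nat \<Rightarrow> int" where b: "\<forall>i. b i \<in> {0, 1}"
    "(\<Sum>i=1..n. 2 ^ (i - 1) * b i) = int (k - c * 2 ^ n)" by blast
  let ?b = "b(Suc n := int c)"
  have "(\<Sum>i=1..n. 2 ^ (i - 1) * ?b i) = (\<Sum>i=1..n. 2 ^ (i - 1) * b i)"
    by (rule sum.cong) auto
  then have "(\<Sum>i=1..Suc n. 2 ^ (i - 1) * ?b i) = (\<Sum>i=1..n. 2 ^ (i - 1) * b i) + 2 ^ n * int c"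
    by simp
  also have "\<dots> = int k"
    using k by (simp only: b(2)) (metis mult.commute of_nat_add of_nat_mult of_nat_numeral of_nat_power)
  finally show ?case
    using b(1) by (intro exI[of _ ?b]) (auto simp: c_def)
qed

text \<open>The extension variables are set one by one, starting from the value 0 everywhere. Since
  \<open>Q ! j\<close> mentions only \<open>Y 1\<close> to \<open>Y j\<close>, setting
  \<open>Y (m + 1)\<close> changes no \<open>Q ! j\<close> with j \<le> m, so the equations already
  achieved survive.\<close>

lemma extension_assignment_exists:
  fixes Q :: "(indet, 'a::comm_ring_1) mpoly list"
  assumes "\<forall>j<length Q. vars (Q ! j) \<subseteq> X ` {1..n} \<union> Y ` {1..j}"
  shows "\<exists>\<rho>. (\<forall>i. \<rho> (X i) = b i) \<and> (\<forall>j<length Q. \<rho> (Y (j + 1)) = eval_mpoly \<rho> (Q ! j))"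
proof -
  have "\<exists>\<rho>. (\<forall>i. \<rho> (X i) = b i) \<and> (\<forall>j<m. \<rho> (Y (j + 1)) = eval_mpoly \<rho> (Q ! j))"
    if "m \<le> length Q" for m
    using that
  proof (induction m)
    case 0
    then show ?case
      by (intro exI[of _ "case_indet b (\<lambda>_. 0)"]) auto
  next
    case (Suc m)
    then obtain \<rho> where \<rho>: "\<forall>i. \<rho> (X i) = b i" "\<forall>j<m. \<rho> (Y (j + 1)) = eval_mpoly \<rho> (Q ! j)"
      by auto
    define \<sigma> where "\<sigma> = \<rho>(Y (m + 1) := eval_mpoly \<rho> (Q ! m))"
    have "eval_mpoly \<sigma> (Q ! j) = eval_mpoly \<rho> (Q ! j)" if "j \<le> m" for j
    proof (rule eval_mpoly_cong)
      fix v assume "v \<in> vars (Q ! j)"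
      then have "v \<in> X ` {1..n} \<union> Y ` {1..j}"
        using assms[rule_format, of j] Suc.prems that by auto
      then show "\<sigma> v = \<rho> v"
        using that by (auto simp: \<sigma>_def)
    qed
    then show ?case
      using \<rho> by (intro exI[of _ \<sigma>]) (simp_all add: less_Suc_eq all_conj_distrib, auto simp: \<sigma>_def)
  qed
  then show ?thesis by blast
qed

text \<open>Under the digits of \<open>p - 1\<close> the linear axiom evaluates to exactly
  \<open>p\<close>, and all other axioms evaluate to 0. The bound is non-strict so that
  \<open>p = 2\<close> is available at \<open>n = 1\<close>.\<close>

lemma prime_dvd_BVP_constant:
  fixes M :: int
  assumes ref: "ext_pc_sqrt_refutation n (BVP n) Q R M" and "prime p" "p \<le> 2 ^ n"
  shows "int p dvd M"
proof -
  have p1: "p \<ge> 1" using \<open>prime p\<close> by (rule prime_ge_1_nat)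
  then have "p - 1 < 2 ^ n" using \<open>p \<le> 2 ^ n\<close> by linarith
  then obtain b :: "nat \<Rightarrow> int" where b: "\<And>i. b i \<in> {0, 1}"
      "(\<Sum>i=1..n. 2 ^ (i - 1) * b i) = int (p - 1)"
    using bit_assignment_exists by blast
  obtain \<rho> where \<rho>: "\<forall>i. \<rho> (X i) = b i" "\<forall>j<length Q. \<rho> (Y (j + 1)) = eval_mpoly \<rho> (Q ! j)"
    using extension_assignment_exists[of Q n b] ref by (auto simp: ext_pc_sqrt_refutation_def)
  show ?thesis
  proof (rule prime_dvd_eval_refutation)
    show "prime (int p)" using \<open>prime p\<close> by simp
    show "pc_sqrt_refutation (X ` {1..n} \<union> Y ` {1..length Q})
       (BVP n \<union> {Var (Y (j + 1)) - Q ! j | j. j < length Q}) R M"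
      using ref by (simp add: ext_pc_sqrt_refutation_def)
  next
    fix g assume "g \<in> BVP n \<union> {Var (Y (j + 1)) - Q ! j | j. j < length Q}"
    then consider "g = (\<Sum>i=1..n. Const (2 ^ (i - 1)) * Var (X i)) + 1"
      | i where "g = (Var (X i))\<^sup>2 - Var (X i)"
      | j where "j < length Q" "g = Var (Y (j + 1)) - Q ! j"
      unfolding BVP_def by blast
    then show "int p dvd eval_mpoly \<rho> g"
    proof cases
      case 1
      have "eval_mpoly \<rho> g = (\<Sum>i=1..n. 2 ^ (i - 1) * b i) + 1"
        by (simp add: 1 eval_mpoly_add eval_mpoly_sum eval_mpoly_mult \<rho>)
      also have "\<dots> = int p" using p1 by (simp only: b(2))
      finally show ?thesis by simp
    next
      case (2 i)
      have "(b i)\<^sup>2 - b i = 0" using b(1)[of i] by auto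
      then show ?thesis by (simp add: 2 eval_mpoly_diff eval_mpoly_power2 \<rho>)
    next
      case 3
      then show ?thesis using \<rho>(2) by (simp add: eval_mpoly_diff)
    qed
  qed
qed

section \<open>A lower bound for primorials\<close>

lemma binomial_dvd_Lcm:
  assumes "1 \<le> k" "k \<le> n"
  shows "k * (n choose k) dvd Lcm {1..n}"
proof -
  define d where "d n k = real k * real (n choose k)" for n k :: nat
  \<comment> \<open>the recurrence of Leibniz's harmonic triangle\<close>
  have rec: "1 / d (Suc n) (Suc k) = 1 / d n k - 1 / d (Suc n) k" if "1 \<le> k" "k \<le> n" for n k
  proof -
    have a: "d (Suc n) (Suc k) = real (Suc n) * real (n choose k)"
      unfolding d_def using Suc_times_binomial_eq[of n k] by (metis mult.commute of_nat_mult)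
    have "real (Suc n - k) * real (Suc n choose k) = real (Suc n) * real (n choose k)"
      using binomial_absorb_comp[of "Suc n" k] by (metis diff_Suc_1 of_nat_mult)
    then have "real (Suc n choose k) = real (Suc n) * real (n choose k) / (real n + 1 - real k)"
      using that by (simp add: field_simps of_nat_diff)
    then have b: "d (Suc n) k = real k * (real (Suc n) * real (n choose k) / (real n + 1 - real k))"
      by (simp add: d_def)
    \<comment> \<open>With \<open>c = n choose k\<close>, \<open>y = k\<close> and
      \<open>x = n + 1\<close>, the three denominators are \<open>d (Suc n) (Suc k)\<close>,
      \<open>d n k\<close> and \<open>d (Suc n) k\<close>.\<close>
    have "1 / (x * c) = 1 / (y * c) - 1 / (y * (x * c / (x - y)))" if "c > 0" "y > 0" "x > y" for c x y :: real
      using that by (simp add: field_simps)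
    from this[of "real (n choose k)" "real k" "real (Suc n)"] show ?thesis
      unfolding a b d_def[of n k] using that by (simp add: add.commute)
  qed
  \<comment> \<open>Induction on the column \<open>k\<close>. Quantifying over every common multiple
    \<open>N\<close> lets the hypothesis apply to the rows \<open>n\<close> and \<open>n - 1\<close>
    with the same \<open>N\<close>; in column 1 the denominator is \<open>n\<close> itself.\<close>
  have "\<forall>n\<ge>k. \<forall>N. (\<forall>i\<in>{1..n}. i dvd N) \<longrightarrow> real N / d n k \<in> \<int>"
    using \<open>1 \<le> k\<close>
  proof (induction k rule: dec_induct)
    case base
    show ?case
    proof (intro allI impI)
      fix n N :: nat assume "1 \<le> n" "\<forall>i\<in>{1..n}. i dvd N"
      then have "n dvd N" by auto
      then show "real N / d n 1 \<in> \<int>" using \<open>1 \<le> n\<close> by (auto simp: d_def elim!: dvdE)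
    qed
  next
    case (step j)
    show ?case
    proof (intro allI impI)
      fix n N :: nat assume n: "Suc j \<le> n" and N: "\<forall>i\<in>{1..n}. i dvd N"
      then obtain m where m: "n = Suc m" "j \<le> m" by (cases n) auto
      have "real N / d n (Suc j) = real N / d m j - real N / d n j"
      proof -
        have "real N / d n (Suc j) = real N * (1 / d n (Suc j))" by simp
        also have "1 / d n (Suc j) = 1 / d m j - 1 / d n j"
          unfolding m(1) using m(2) step.hyps by (intro rec) auto
        finally show ?thesis by (simp add: right_diff_distrib)
      qed
      moreover have "real N / d m j \<in> \<int>" "real N / d n j \<in> \<int>"
        using step.IH m N by auto
      ultimately show "real N / d n (Suc j) \<in> \<int>" by simp
    qed
  qed
  then have "real (Lcm {1..n}) / real (k * (n choose k)) \<in> \<int>"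
    using \<open>k \<le> n\<close> by (auto simp: d_def)
  then have "real_of_int (int (Lcm {1..n})) / real_of_int (int (k * (n choose k))) \<in> \<int>"
    by simp
  then show ?thesis
    unfolding of_int_div_of_int_in_Ints_iff of_nat_dvd_iff using assms by simp
qed

lemma Lcm_interval_pos: "Lcm {1..n::nat} > 0"
  by (intro Nat.gr0I) (simp add: Lcm_0_iff)

text \<open>The factor \<open>m\<close> gained in \<open>binomial_dvd_Lcm\<close> cancels the
  denominator of the central binomial bound \<open>4 ^ m / (2 * m)\<close>, leaving only the
  constant 2.\<close>

lemma four_power_le_Lcm:
  assumes "m > 0"
  shows "4 ^ m \<le> 2 * Lcm {1..2 * m}"
proof -
  have "4 ^ m / (2 * real m) \<le> real ((2 * m) choose m)"
    using central_binomial_lower_bound[OF assms] .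
  then have "(4::real) ^ m \<le> real (2 * (m * ((2 * m) choose m)))"
    using assms by (simp add: field_simps)
  then have "4 ^ m \<le> 2 * (m * ((2 * m) choose m))"
    by (metis of_nat_le_iff of_nat_numeral of_nat_power)
  also have "m * ((2 * m) choose m) \<le> Lcm {1..2 * m}"
    using binomial_dvd_Lcm[of m "2 * m"] assms by (intro dvd_imp_le Lcm_interval_pos) auto
  finally show ?thesis by simp
qed

text \<open>The exponent of \<open>p\<close> in a least common multiple is the maximum of the
  exponents in its arguments, so this power of \<open>p\<close> divides a single number that is at
  most \<open>n\<close>.\<close>

lemma prime_power_multiplicity_Lcm_le:
  fixes p :: nat
  assumes "prime p" "n \<ge> 1"
  shows "p ^ multiplicity p (Lcm {1..n}) \<le> n"
  using \<open>n \<ge> 1\<close>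
proof (induction n rule: dec_induct)
  case base
  then show ?case by simp
next
  case (step m)
  have "{1..Suc m} = insert (Suc m) {1..m}" by auto
  then have "multiplicity p (Lcm {1..Suc m}) = max (multiplicity p (Suc m)) (multiplicity p (Lcm {1..m}))"
    using Lcm_interval_pos[of m] by (simp add: multiplicity_lcm \<open>prime p\<close> del: One_nat_def)
  moreover have "p ^ multiplicity p (Suc m) \<le> Suc m"
    by (intro dvd_imp_le multiplicity_dvd) auto
  ultimately show ?case
    using step.IH by (simp add: max_def)
qed

text \<open>A prime above \<open>s\<close> has p^2 > s^2 \<ge> n, so it occurs at most once in the
  least common multiple. For each of the at most \<open>s\<close> other primes, an extra factor
  \<open>n\<close> covers the whole prime power.\<close>

lemma Lcm_le_primorial:
  fixes n s :: nat
  assumes "n \<ge> 1" "n \<le> s\<^sup>2"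
  shows "Lcm {1..n} \<le> \<Prod>{p. prime p \<and> p \<le> n} * n ^ s"
proof -
  let ?L = "Lcm {1..n}" and ?P = "{p. prime p \<and> p \<le> n}"
  have fin: "finite ?P" by (rule finite_subset[of _ "{..n}"]) auto
  have L0: "?L \<noteq> 0" using Lcm_interval_pos[of n] by simp
  have mult_le: "p ^ multiplicity p ?L \<le> n" if "prime p" for p
    using prime_power_multiplicity_Lcm_le[OF that \<open>n \<ge> 1\<close>] .
  have sub: "prime_factors ?L \<subseteq> ?P"
  proof
    fix p assume p: "p \<in> prime_factors ?L"
    then have "prime p" "multiplicity p ?L > 0" by (auto simp: prime_factors_multiplicity)
    moreover have "p \<le> p ^ multiplicity p ?L"
      using prime_ge_1_nat[OF \<open>prime p\<close>] \<open>multiplicity p ?L > 0\<close> by (rule self_le_power)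
    ultimately show "p \<in> ?P" using mult_le[of p] by auto
  qed
  have "?L = (\<Prod>p\<in>prime_factors ?L. p ^ multiplicity p ?L)"
    using L0 by (rule prime_factorization_nat[OF neq0_conv[THEN iffD1]])
  also have "\<dots> \<le> (\<Prod>p\<in>?P. p * (if p \<le> s then n else 1))"
  proof (rule order_trans)
    show "(\<Prod>p\<in>prime_factors ?L. p ^ multiplicity p ?L) \<le> (\<Prod>p\<in>?P. p ^ multiplicity p ?L)"
      by (rule eq_refl, rule prod.mono_neutral_left)
         (use fin sub in \<open>auto simp: prime_factors_multiplicity\<close>)
    show "(\<Prod>p\<in>?P. p ^ multiplicity p ?L) \<le> (\<Prod>p\<in>?P. p * (if p \<le> s then n else 1))"
    proof (rule prod_mono, safe)
      fix p :: nat assume p: "prime p" "p \<le> n"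
      show "p ^ multiplicity p ?L \<le> p * (if p \<le> s then n else 1)"
      proof (cases "p \<le> s")
        case True
        have "n \<le> p * n" using prime_ge_1_nat[OF p(1)] by simp
        then show ?thesis using True mult_le[OF p(1)] by (simp only: if_True)
      next
        case False
        have "multiplicity p ?L \<le> 1"
        proof (rule ccontr)
          assume "\<not> multiplicity p ?L \<le> 1"
          then have "p\<^sup>2 \<le> p ^ multiplicity p ?L"
            using prime_ge_1_nat[OF p(1)] by (intro power_increasing) auto
          also have "\<dots> \<le> s\<^sup>2" using mult_le[OF p(1)] assms(2) by linarith
          finally show False using False by (simp add: power2_nat_le_eq_le)
        qed
        then have "p ^ multiplicity p ?L \<le> p ^ 1"
          using prime_ge_1_nat[OF p(1)] by (intro power_increasing) auto
        then show ?thesis using False by simp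
      qed
    qed
  qed
  also have "\<dots> = \<Prod>?P * n ^ card {p \<in> ?P. p \<le> s}"
    using fin by (simp add: prod.distrib prod.If_cases Int_def)
  also have "\<dots> \<le> \<Prod>?P * n ^ s"
  proof -
    have "card {p \<in> ?P. p \<le> s} \<le> card {1..s}"
      by (rule card_mono) (auto simp: prime_ge_1_nat[unfolded One_nat_def])
    then show ?thesis using \<open>n \<ge> 1\<close> by (simp add: power_increasing)
  qed
  finally show ?thesis .
qed

text \<open>Absorbs the factor \<open>n\<close> of the error exponent in
  \<open>primorial_power2_ge\<close>. The inequality fails at \<open>k = 5\<close>, whence the
  threshold \<open>n = 11\<close> there.\<close>

lemma Suc_mult_le_power2: "k \<ge> 6 \<Longrightarrow> 2 * k + 1 \<le> (2::nat) ^ (k - 2)"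
proof (induction k rule: dec_induct)
  case (step m)
  then have "(2::nat) ^ (Suc m - 2) = 2 * 2 ^ (m - 2)"
    by (simp add: Suc_diff_le flip: power_Suc)
  then show ?case using step.IH by simp
qed simp

text \<open>Taking \<open>m = 2 ^ (n - 1)\<close> and \<open>s = 2 ^ k\<close> in the two bounds on
  the least common multiple, the available exponent of 2 is \<open>2 ^ n\<close>. The error
  \<open>n * 2 ^ k + 1\<close> uses at most half of it; its \<open>+ 1\<close> pays for the factor 2
  in \<open>four_power_le_Lcm\<close>.\<close>

lemma primorial_power2_ge:
  assumes "n \<ge> 11"
  shows "2 ^ (2 ^ (n - 1)) \<le> \<Prod>{p::nat. prime p \<and> p \<le> 2 ^ n}"
proof -
  \<comment> \<open>Half of \<open>n\<close> rounded up: large enough for \<open>2 ^ k\<close> to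
    bound the square root of \<open>2 ^ n\<close>, small enough for \<open>2 * k - 2\<close> not to
    exceed \<open>n - 1\<close>.\<close>
  define k where "k = (n + 1) div 2"
  have k: "k \<ge> 6" "n \<le> 2 * k" "2 * k - 2 \<le> n - 1"
    using assms by (auto simp: k_def)
  have "n * 2 ^ k + 1 \<le> (2 * k + 1) * (2::nat) ^ k"
    unfolding add_mult_distrib using k(2) by (intro add_mono mult_right_mono) auto
  also have "\<dots> \<le> 2 ^ (k - 2) * 2 ^ k"
    using Suc_mult_le_power2[OF k(1)] by (intro mult_right_mono) auto
  also have "\<dots> = 2 ^ (2 * k - 2)"
    using k by (simp flip: power_add add: mult_2)
  also have "\<dots> \<le> 2 ^ (n - 1)"
    using k by (intro power_increasing) auto
  finally have small: "n * 2 ^ k + 1 \<le> (2::nat) ^ (n - 1)" .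
  have double: "(2::nat) ^ n = 2 * 2 ^ (n - 1)"
    using assms by (cases n) auto
  let ?P = "\<Prod>{p::nat. prime p \<and> p \<le> 2 ^ n}"
  have "(2::nat) ^ n \<le> (2 ^ k)\<^sup>2"
    using k by (simp flip: power_mult add: mult.commute)
  then have le: "Lcm {1..(2::nat) ^ n} \<le> ?P * (2 ^ n) ^ (2 ^ k)"
    by (intro Lcm_le_primorial) auto
  have "(2::nat) ^ (2 ^ (n - 1)) * 2 ^ (n * 2 ^ k + 1) \<le> 2 ^ (2 ^ (n - 1)) * 2 ^ (2 ^ (n - 1))"
    using small by (intro mult_left_mono power_increasing) auto
  also have "\<dots> = 4 ^ (2 ^ (n - 1))"
    by (simp flip: power_mult_distrib)
  also have "\<dots> \<le> 2 * Lcm {1..2 ^ n}"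
    using four_power_le_Lcm[of "2 ^ (n - 1)"] by (simp add: double)
  also have "\<dots> \<le> ?P * 2 ^ (n * 2 ^ k + 1)"
    using le by (simp add: power_mult)
  finally show ?thesis by simp
qed

section \<open>Size bounds\<close>

lemma primes_prod_dvd:
  fixes M :: int
  assumes "finite A" "\<And>p::nat. p \<in> A \<Longrightarrow> prime p" "\<And>p. p \<in> A \<Longrightarrow> int p dvd M"
  shows "int (\<Prod>A) dvd M"
  using assms
proof (induction A rule: finite_induct)
  case (insert p A)
  have "coprime p (\<Prod>A)"
    using insert by (intro prod_coprime_right) (auto intro!: primes_coprime)
  then have "coprime (int p) (int (\<Prod>A))" by (simp only: coprime_int_iff)
  then have "int p * int (\<Prod>A) dvd M"
    using insert by (intro divides_mult) auto
  then show ?case using insert by simp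
qed simp

text \<open>The constant is \<open>2 ^ (- 11)\<close>: it makes the bound at most 1 for all
  \<open>n\<close> below the threshold 11 of the primorial estimate, where divisibility by 2
  suffices.\<close>

lemma log_BVP_constant_ge:
  fixes M :: int
  assumes "n \<ge> 1" "ext_pc_sqrt_refutation n (BVP n) Q R M"
  shows "log 2 (real_of_int \<bar>M\<bar>) \<ge> 1 / 2048 * 2 ^ n"
proof -
  have M0: "M \<noteq> 0"
    using assms(2) by (auto simp: ext_pc_sqrt_refutation_def pc_sqrt_refutation_def)
  have dvd: "int p dvd M" if "prime p" "p \<le> 2 ^ n" for p
    using prime_dvd_BVP_constant[OF assms(2) that] .
  show ?thesis
  proof (cases "n \<ge> 11")
    case True
    let ?A = "{p::nat. prime p \<and> p \<le> 2 ^ n}"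
    have "finite ?A" by (rule finite_subset[of _ "{..2 ^ n}"]) auto
    then have "int (\<Prod>?A) dvd M"
      by (rule primes_prod_dvd) (use dvd in auto)
    then have "int (\<Prod>?A) \<le> \<bar>M\<bar>"
      using M0 by (simp add: zdvd_imp_le)
    moreover have "int (2 ^ (2 ^ (n - 1))) \<le> int (\<Prod>?A)"
      using primorial_power2_ge[OF True] by (simp only: of_nat_le_iff)
    ultimately have "int (2 ^ (2 ^ (n - 1))) \<le> \<bar>M\<bar>" by linarith
    then have "(2::real) ^ (2 ^ (n - 1)) \<le> real_of_int \<bar>M\<bar>"
      by (metis of_int_le_iff of_int_of_nat_eq of_nat_numeral of_nat_power)
    then have "real (2 ^ (n - 1)) \<le> log 2 (real_of_int \<bar>M\<bar>)"
      using M0 by (intro le_log_of_power) auto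
    moreover have "(2::real) ^ n = 2 * 2 ^ (n - 1)"
      using assms(1) by (cases n) auto
    moreover have "(0::real) \<le> 2 ^ (n - 1)" by simp
    ultimately show ?thesis unfolding of_nat_power of_nat_numeral by linarith
  next
    case False
    have "(2::nat) ^ 1 \<le> 2 ^ n" using assms(1) by (intro power_increasing) auto
    then have "2 dvd M" using dvd[of 2] by simp
    then have "2 \<le> \<bar>M\<bar>" using M0 zdvd_imp_le[of 2 "\<bar>M\<bar>"] by simp
    then have "1 \<le> log 2 (real_of_int \<bar>M\<bar>)" by (simp add: le_log_iff)
    moreover have "(2::real) ^ n \<le> 2 ^ 11" using False by (intro power_increasing) auto
    ultimately show ?thesis by simp
  qed
qed

section \<open>From the bits of the constant to the size of a refutation\<close>

lemma poly_bits_nonneg: "poly_bits p \<ge> 0"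
  unfolding poly_bits_def
proof (rule sum_nonneg)
  fix m assume "m \<in> Poly_Mapping.keys p"
  then have "\<bar>Poly_Mapping.lookup p m\<bar> \<ge> 1" by (auto simp: in_keys_iff)
  then have "log 2 (real_of_int \<bar>Poly_Mapping.lookup p m\<bar>) \<ge> 0"
    by (subst zero_le_log_cancel_iff) linarith+
  then show "\<lceil>log 2 (real_of_int \<bar>Poly_Mapping.lookup p m\<bar>)\<rceil> \<ge> 0" by linarith
qed

lemma refutation_bits_ge_last:
  assumes "R \<noteq> []"
  shows "refutation_bits R \<ge> poly_bits (last R)"
  unfolding refutation_bits_def
  using assms by (intro member_le_sum_list) (auto simp: poly_bits_nonneg)

text \<open>No line has negative size, so the last line alone bounds the total from below; its only
  coefficient is \<open>M\<close>.\<close>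

lemma refutation_bits_ge_log:
  assumes "pc_sqrt_refutation V \<Gamma> R M"
  shows "real_of_int (refutation_bits R) \<ge> log 2 (real_of_int \<bar>M\<bar>)"
proof -
  have "R \<noteq> []" "last R = Const M" "M \<noteq> 0"
    using assms by (auto simp: pc_sqrt_refutation_def)
  then have "refutation_bits R \<ge> \<lceil>log 2 (real_of_int \<bar>M\<bar>)\<rceil>"
    using refutation_bits_ge_last[of R] by (simp add: Const_def poly_bits_def)
  then show ?thesis by linarith
qed

lemma bitlen_ge_log: "x > 0 \<Longrightarrow> real_of_int (bitlen x) \<ge> log 2 (real_of_int x)"
  by (simp add: bitlen_alt_def)

theorem theorem3p1:
  shows "(\<exists>C::real. C > 0 \<and>
           (\<forall>n\<ge>1. \<forall>(Q :: (indet, int) mpoly list) R M.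
              ext_pc_sqrt_refutation n (BVP n) Q R M \<longrightarrow>
              real_of_int (refutation_bits R) \<ge> C * 2 ^ n)) \<and>
         (\<exists>C::real. C > 0 \<and>
           (\<forall>n\<ge>1. \<forall>(Q :: (indet, int) mpoly list) R M.
              ext_pc_sqrt_refutation n (BVP n) Q R M \<longrightarrow>
              real_of_int (bitlen \<bar>M\<bar>) \<ge> C * 2 ^ n)) \<and>
         (\<forall>n\<ge>1. \<forall>(Q :: (indet, int) mpoly list) R M.
            ext_pc_sqrt_refutation n (BVP n) Q R M \<longrightarrow>
            (\<forall>p::nat. prime p \<and> p < 2 ^ n \<longrightarrow> int p dvd M))"
proof (intro conjI)
  have "real_of_int (refutation_bits R) \<ge> 1 / 2048 * 2 ^ n"
    if "n \<ge> 1" "ext_pc_sqrt_refutation n (BVP n) Q R M" for n Q R and M :: int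
    using log_BVP_constant_ge[OF that] that(2) refutation_bits_ge_log
    unfolding ext_pc_sqrt_refutation_def by (meson order_trans)
  then show "\<exists>C::real. C > 0 \<and>
           (\<forall>n\<ge>1. \<forall>(Q :: (indet, int) mpoly list) R M.
              ext_pc_sqrt_refutation n (BVP n) Q R M \<longrightarrow>
              real_of_int (refutation_bits R) \<ge> C * 2 ^ n)"
    by (intro exI[of _ "1 / 2048"]) auto
  have "real_of_int (bitlen \<bar>M\<bar>) \<ge> 1 / 2048 * 2 ^ n"
    if "n \<ge> 1" "ext_pc_sqrt_refutation n (BVP n) Q R M" for n Q R and M :: int
  proof -
    have "\<bar>M\<bar> > 0"
      using that(2) by (auto simp: ext_pc_sqrt_refutation_def pc_sqrt_refutation_def)
    from bitlen_ge_log[OF this] show ?thesis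
      using log_BVP_constant_ge[OF that] by linarith
  qed
  then show "\<exists>C::real. C > 0 \<and>
           (\<forall>n\<ge>1. \<forall>(Q :: (indet, int) mpoly list) R M.
              ext_pc_sqrt_refutation n (BVP n) Q R M \<longrightarrow>
              real_of_int (bitlen \<bar>M\<bar>) \<ge> C * 2 ^ n)"
    by (intro exI[of _ "1 / 2048"]) auto
  show "\<forall>n\<ge>1. \<forall>(Q :: (indet, int) mpoly list) R M.
            ext_pc_sqrt_refutation n (BVP n) Q R M \<longrightarrow>
            (\<forall>p::nat. prime p \<and> p < 2 ^ n \<longrightarrow> int p dvd M)"
    using prime_dvd_BVP_constant by (meson less_imp_le)
qed

end
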